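(* Let $G$ be a finite group. Then the power graph $P(G)$ is not a cograph if and only if $G$ contains elements $g$ and $h$ with orders $pr$ and $pq$ respectively, where $p,q,r$ are prime numbers and $p\ne q$, such that (a) $g^r=h^q$; and (b) if $q=r$, then $g^p\notin\langle h^p\rangle$.
   Context: The (undirected) power graph $P(G)$ of a finite group $G$ is the simple graph with vertex set $G$ in which two distinct vertices $u,v$ are adjacent if and only if one of $u,v$ is a power of the other. A graph is a cograph if it has no induced subgraph isomorphic to the path $P_4$ on four vertices. The prime $r$ is allowed to equal $p$ or $q$. *)

theory Defs
  imports
    "HOL-Algebra.Multiplicative_Group"
    "Graph_Theory.Pair_Digraph"
    "Graph_Theory.Digraph_Isomorphism"
    "HOL-Computational_Algebra.Primes"
begin

text \<open>
  Simple graphs are the loop-free symmetric digraphs of the Graph Theory library: an undirected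
  edge between \<open>u\<close> and \<open>v\<close> is the pair of arcs \<open>(u, v)\<close> and \<open>(v, u)\<close>.
\<close>

definition power_graph :: "('a, 'm) monoid_scheme \<Rightarrow> 'a pair_pre_digraph" where
  "power_graph G =
    \<lparr> pverts = carrier G,
      parcs = {(u, v). u \<in> carrier G \<and> v \<in> carrier G \<and> u \<noteq> v \<and>
                       ((\<exists>k::int. u = v [^]\<^bsub>G\<^esub> k) \<or> (\<exists>k::int. v = u [^]\<^bsub>G\<^esub> k))} \<rparr>"

definition path_P4 :: "nat pair_pre_digraph" where
  "path_P4 =
    \<lparr> pverts = {0, 1, 2, 3},
      parcs = {(0, 1), (1, 0), (1, 2), (2, 1), (2, 3), (3, 2)} \<rparr>"

definition cograph :: "('a, 'b) pre_digraph \<Rightarrow> bool" where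
  "cograph \<Gamma> \<longleftrightarrow> \<not> (\<exists>H. induced_subgraph H \<Gamma> \<and> digraph_iso H (with_proj path_P4))"

text \<open>
  The library's \<open>induced_subgraph\<close> demands well-formedness of the ambient graph, so \<open>cograph\<close>
  would hold vacuously for an ill-formed one; the following facts exclude this.
\<close>

lemma pair_graph_power_graph:
  assumes "finite (carrier G)"
  shows "pair_graph (power_graph G)"
proof
  show "finite (parcs (power_graph G))"
    by (rule finite_subset[of _ "carrier G \<times> carrier G"]) (auto simp: power_graph_def assms)
qed (auto simp: power_graph_def assms arcs_ends_conv symmetric_def intro!: symI)

lemma pair_graph_path_P4: "pair_graph path_P4"
  by unfold_locales (auto simp: path_P4_def symmetric_def intro!: symI)

lemma not_cograph_iff:
  assumes "pair_wf_digraph \<Gamma>"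
  shows "\<not> cograph (with_proj \<Gamma>) \<longleftrightarrow>
    (\<exists>a b c d. {a, b, c, d} \<subseteq> pverts \<Gamma> \<and> distinct [a, b, c, d] \<and>
       parcs \<Gamma> \<inter> {a, b, c, d} \<times> {a, b, c, d} =
         {(a, b), (b, a), (b, c), (c, b), (c, d), (d, c)})"
    (is "_ \<longleftrightarrow> ?P4")
proof
  interpret pair_wf_digraph \<Gamma> by (rule assms)
  assume "\<not> cograph (with_proj \<Gamma>)"
  then obtain H where ind: "induced_subgraph H (with_proj \<Gamma>)"
    and iso: "digraph_iso H (with_proj path_P4)"
    unfolding cograph_def by blast
  have H_arcs: "arcs H = {e \<in> parcs \<Gamma>. fst e \<in> verts H \<and> snd e \<in> verts H}"
    and H_verts: "verts H \<subseteq> pverts \<Gamma>"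
    and H_proj: "tail H = fst" "head H = snd"
    using ind by (auto simp: induced_subgraph_def subgraph_def compatible_def)
  obtain f where f: "pre_digraph.digraph_isomorphism H f" "with_proj path_P4 = app_iso f H"
    using iso unfolding digraph_iso_def by blast
  define v where "v = iso_verts f"
  have verts_f: "v ` verts H = {0, 1, 2, 3}"
    using arg_cong[OF f(2), of verts] by (simp add: path_P4_def v_def)
  have arcs_f: "iso_arcs f ` arcs H = parcs path_P4" "iso_tail f = fst" "iso_head f = snd"
    using arg_cong[OF f(2), of arcs] arg_cong[OF f(2), of tail] arg_cong[OF f(2), of head]
    by (simp_all add: path_P4_def)
  have inj: "inj_on v (verts H)"
    using f(1) by (simp add: pre_digraph.digraph_isomorphism_def v_def)
  have iso_arc: "iso_arcs f e = (v (fst e), v (snd e))" if "e \<in> arcs H" for e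
    using f(1) that unfolding pre_digraph.digraph_isomorphism_def H_proj arcs_f v_def
    by (metis prod.collapse)
  have arc_iff: "(x, y) \<in> parcs \<Gamma> \<longleftrightarrow> (v x, v y) \<in> parcs path_P4"
    if "x \<in> verts H" "y \<in> verts H" for x y
  proof
    assume "(x, y) \<in> parcs \<Gamma>"
    then have "(x, y) \<in> arcs H" using that by (simp add: H_arcs)
    then show "(v x, v y) \<in> parcs path_P4" using iso_arc arcs_f(1) by force
  next
    assume "(v x, v y) \<in> parcs path_P4"
    then obtain e where e: "e \<in> arcs H" "(v x, v y) = (v (fst e), v (snd e))"
      using arcs_f(1) iso_arc by (metis imageE)
    then have "fst e = x" "snd e = y"
      using inj that by (auto simp: H_arcs dest: inj_onD)
    then show "(x, y) \<in> parcs \<Gamma>" using e(1) by (auto simp: H_arcs)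
  qed
  have "0 \<in> v ` verts H" "1 \<in> v ` verts H" "2 \<in> v ` verts H" "3 \<in> v ` verts H"
    using verts_f by simp_all
  then obtain a b c d where abcd: "a \<in> verts H" "b \<in> verts H" "c \<in> verts H" "d \<in> verts H"
    "v a = 0" "v b = 1" "v c = 2" "v d = 3" by (elim imageE) simp
  then have dist: "distinct [a, b, c, d]" by auto
  have edge: "e \<in> parcs \<Gamma> \<inter> {a, b, c, d} \<times> {a, b, c, d} \<longleftrightarrow>
      e \<in> {(a, b), (b, a), (b, c), (c, b), (c, d), (d, c)}" for e
  proof -
    have "(x, y) \<in> parcs \<Gamma> \<longleftrightarrow> (x, y) \<in> {(a, b), (b, a), (b, c), (c, b), (c, d), (d, c)}"
      if "x \<in> {a, b, c, d}" "y \<in> {a, b, c, d}" for x y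
    proof -
      have "(x, y) \<in> parcs \<Gamma> \<longleftrightarrow> (v x, v y) \<in> parcs path_P4"
        using that abcd(1-4) arc_iff by blast
      also have "\<dots> \<longleftrightarrow> (x, y) \<in> {(a, b), (b, a), (b, c), (c, b), (c, d), (d, c)}"
        using that dist not_sym[of a b] not_sym[of a c] not_sym[of a d]
          not_sym[of b c] not_sym[of b d] not_sym[of c d]
        by (elim insertE emptyE) (simp_all add: abcd(5-8) path_P4_def)
      finally show ?thesis .
    qed
    then show ?thesis by (cases e) blast
  qed
  have "parcs \<Gamma> \<inter> {a, b, c, d} \<times> {a, b, c, d} =
      {(a, b), (b, a), (b, c), (c, b), (c, d), (d, c)}"
    by (intro Set.set_eqI) (rule edge)
  moreover have "{a, b, c, d} \<subseteq> pverts \<Gamma>"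
    using abcd(1-4) H_verts by blast
  ultimately show ?P4
    using dist by blast
next
  interpret pair_wf_digraph \<Gamma> by (rule assms)
  assume ?P4
  then obtain a b c d where abcd: "{a, b, c, d} \<subseteq> pverts \<Gamma>" "distinct [a, b, c, d]"
    "parcs \<Gamma> \<inter> {a, b, c, d} \<times> {a, b, c, d} =
      {(a, b), (b, a), (b, c), (c, b), (c, d), (d, c)}"
    by (elim exE conjE)
  define V where "V = {a, b, c, d}"
  define K where "K = \<lparr> pverts = V, parcs = parcs \<Gamma> \<inter> V \<times> V \<rparr>"
  define v :: "'a \<Rightarrow> nat" where
    "v = (\<lambda>x. if x = a then 0 else if x = b then 1 else if x = c then 2 else 3)"
  define f where "f = \<lparr> iso_verts = v, iso_arcs = map_prod v v, iso_head = snd, iso_tail = fst \<rparr>"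
  have V: "V \<subseteq> pverts \<Gamma>" using abcd(1) by (simp add: V_def)
  have wfK: "wf_digraph (with_proj K)" by unfold_locales (auto simp: K_def)
  have "induced_subgraph (with_proj K) (with_proj \<Gamma>)"
    using V wfK wf_digraph_axioms
    by (auto simp: induced_subgraph_def subgraph_def compatible_def K_def)
  moreover have "digraph_iso (with_proj K) (with_proj path_P4)"
    unfolding digraph_iso_def
  proof (intro exI[of _ f] conjI)
    have val: "v a = 0" "v b = 1" "v c = 2" "v d = 3"
      using abcd(2) by (auto simp: v_def)
    have inj: "inj_on v V" unfolding V_def inj_on_def by (simp add: val)
    have "inj_on (map_prod v v) (parcs K)"
      by (rule inj_on_subset[OF map_prod_inj_on[OF inj inj]]) (auto simp: K_def)
    with inj wfK show "pre_digraph.digraph_isomorphism (with_proj K) f"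
      by (simp add: pre_digraph.digraph_isomorphism_def f_def K_def)
    have "v ` V = pverts path_P4"
      by (simp add: V_def path_P4_def val)
    moreover have "map_prod v v ` (parcs \<Gamma> \<inter> V \<times> V) = parcs path_P4"
      unfolding V_def abcd(3) by (simp add: path_P4_def val)
    ultimately show "with_proj path_P4 = app_iso f (with_proj K)"
      by (simp add: with_proj_def app_iso_def f_def K_def)
  qed
  ultimately show "\<not> cograph (with_proj \<Gamma>)" unfolding cograph_def by blast
qed

end

theory Submission
  imports Defs
begin

text \<open>
  Being a power of another element is a preorder, so the edges of an induced path
  \<open>a, b, c, d\<close> alternate in direction: up to reversal, \<open>b \<in> \<langle>a\<rangle> \<inter> \<langle>c\<rangle>\<close> and \<open>d \<in> \<langle>c\<rangle>\<close>, while
  \<open>a \<notin> \<langle>c\<rangle>\<close>. In the cyclic group \<open>\<langle>c\<rangle>\<close> comparability is divisibility of orders, so incomparability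
  of \<open>b\<close> and \<open>d\<close> gives primes \<open>p \<noteq> q\<close> with \<open>p\<close> dividing \<open>|b|\<close> and \<open>q\<close> dividing \<open>|c|\<close>. Take \<open>h \<in> \<langle>c\<rangle>\<close>
  of order \<open>pq\<close>; then \<open>h\<^sup>q \<in> \<langle>a\<rangle>\<close>. If \<open>pr\<close> divides \<open>|a|\<close> for a prime \<open>r \<noteq> q\<close>, extract an \<open>r\<close>-th root \<open>g\<close>
  of \<open>h\<^sup>q\<close> in \<open>\<langle>a\<rangle>\<close>. Otherwise \<open>|a|\<close> is \<open>p\<close> times a nontrivial power of \<open>q\<close>; take \<open>g \<in> \<langle>a\<rangle>\<close> of order
  \<open>pq\<close> with \<open>g\<^sup>q = h\<^sup>q\<close>. If \<open>g\<^sup>p \<in> \<langle>h\<^sup>p\<rangle>\<close>, then \<open>\<langle>a\<rangle>\<close> and \<open>\<langle>c\<rangle>\<close> also share their subgroup of order \<open>q\<close>,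
  so \<open>|a| \<noteq> pq\<close> because \<open>a \<notin> \<langle>c\<rangle>\<close>; hence \<open>q\<^sup>2\<close> divides \<open>|a|\<close>, and the roles of \<open>p\<close> and \<open>q\<close> can be
  exchanged. Conversely, \<open>g, g\<^sup>r = h\<^sup>q, h, h\<^sup>p\<close> is an induced path.
\<close>

section \<open>Membership and orders in cyclic subgroups\<close>

context group
begin

lemma generate_singleton_subset:
  assumes "z \<in> carrier G" "y \<in> generate G {z}"
  shows "generate G {y} \<subseteq> generate G {z}"
  using assms generate_is_subgroup[of "{z}"] by (intro generate_subgroup_incl) auto

lemma generate_singleton_trans:
  assumes "z \<in> carrier G" "x \<in> generate G {y}" "y \<in> generate G {z}"
  shows "x \<in> generate G {z}"
  using generate_singleton_subset assms by blast

lemma generate_singleton_carrier: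
  assumes "y \<in> carrier G" "x \<in> generate G {y}"
  shows "x \<in> carrier G"
  using assms generate_incl[of "{y}"] by auto

lemma nat_pow_in_generate:
  assumes "x \<in> carrier G"
  shows "x [^] (n::nat) \<in> generate G {x}"
  using assms generate_pow[OF assms] int_pow_int[of G x n] by (auto intro: exI[of _ "int n"])

lemma ord_dvd_if_in_generate:
  assumes "y \<in> carrier G" "x \<in> generate G {y}"
  shows "ord x dvd ord y"
proof -
  obtain i :: int where i: "x = y [^] i"
    using assms by (auto simp: generate_pow)
  have "x [^] ord y = (y [^] i) [^] (int (ord y))"
    using i by (simp add: int_pow_int)
  also have "\<dots> = y [^] (i * int (ord y))"
    using assms(1) by (simp add: int_pow_pow)
  also have "\<dots> = \<one>"
    using assms(1) by (simp add: int_pow_eq_id)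
  finally show ?thesis
    using assms generate_singleton_carrier pow_eq_id by blast
qed

text \<open>If \<open>x\<close> and \<open>y\<close> are the \<open>i\<close>-th and
  \<open>j\<close>-th powers of \<open>c\<close>, divisibility of the orders forces
  \<open>gcd (ord c) j\<close> to divide \<open>i\<close>; Bezout then gives an integer exponent
  taking \<open>y\<close> to \<open>x\<close>.\<close>

lemma in_generate_if_ord_dvd:
  assumes fin: "finite (carrier G)" and c: "c \<in> carrier G"
    and x: "x \<in> generate G {c}" and y: "y \<in> generate G {c}"
    and dvd: "ord x dvd ord y"
  shows "x \<in> generate G {y}"
proof -
  obtain i j :: nat where i: "x = c [^] i" and j: "y = c [^] j"
    using x y generate_pow_on_finite_carrier[OF fin c] by auto
  define N where "N = ord c"
  have N: "N > 0" using ord_ge_1[OF fin c] by (simp add: N_def)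
  have ordy: "N = ord y * gcd N j"
    using ord_pow_gen[OF c, of j] N by (auto simp: j N_def)
  have "x [^] ord y = \<one>"
    using dvd c by (simp add: i pow_eq_id)
  then have "c [^] (i * ord y) = \<one>"
    using c by (simp add: i nat_pow_pow)
  then have "ord y * gcd N j dvd ord y * i"
    using c ordy by (metis N_def mult.commute pow_eq_id)
  then have "gcd N j dvd i"
    using N ordy by (metis mult_0 nat_mult_dvd_cancel1 neq0_conv)
  then obtain t where t: "i = gcd N j * t" by (rule dvdE)
  obtain u v where uv: "u * int N + v * int j = gcd (int N) (int j)"
    using bezout_int by blast
  have "int i = (u * int N + v * int j) * int t"
    by (simp add: uv t)
  then have "int j * (v * int t) - int i = int N * (- u * int t)"
    by (simp add: algebra_simps)
  then have "int N dvd int j * (v * int t) - int i"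
    by simp
  then have "c [^] int i = c [^] (int j * (v * int t))"
    using c by (simp add: int_pow_eq N_def)
  then have "x = y [^] (v * int t)"
    using c by (simp add: i j int_pow_int flip: int_pow_pow)
  then show ?thesis
    using c by (auto simp: j generate_pow)
qed

text \<open>Some power \<open>x\<close> of \<open>a\<close> has order \<open>p * r\<close>, and
  \<open>x [^] r\<close> generates the only subgroup of order \<open>p\<close> in
  \<open>generate G {a}\<close>. So \<open>z\<close> is a power of \<open>x [^] r\<close>, and a
  suitable power of \<open>x\<close> is the root.\<close>

lemma exists_root_in_cyclic:
  fixes p r :: nat
  assumes fin: "finite (carrier G)" and a: "a \<in> carrier G"
    and p: "prime p" and r: "prime r" and dvd: "p * r dvd ord a"
    and z: "z \<in> generate G {a}" and ordz: "ord z = p"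
  obtains g where "g \<in> generate G {a}" "ord g = p * r" "g [^] r = z"
proof -
  have pos: "ord a > 0" "p > 0" "r > 0"
    using ord_ge_1[OF fin a] p r by (auto simp: prime_gt_0_nat)
  define x where "x = a [^] (ord a div (p * r))"
  have xc: "x \<in> carrier G" and xa: "x \<in> generate G {a}"
    using a nat_pow_in_generate by (auto simp: x_def)
  obtain s where s: "ord a = p * r * s" using dvd by (rule dvdE)
  have ordx: "ord x = p * r"
    using pos s by (simp add: x_def ord_pow[OF a])
  then have ordxr: "ord (x [^] r) = p"
    using pos by (simp add: ord_pow[OF xc])
  have "z \<in> generate G {x [^] r}"
    by (rule in_generate_if_ord_dvd[OF fin a z])
      (use generate_singleton_trans[OF a nat_pow_in_generate[OF xc] xa] ordz ordxr in auto)
  then obtain i :: nat where i: "z = (x [^] r) [^] i"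
    using generate_pow_on_finite_carrier[OF fin] xc by auto
  have ndvd: "\<not> p dvd i"
  proof
    assume "p dvd i"
    then have "z = \<one>" using i xc ordxr pow_eq_id[of "x [^] r" i] by simp
    then show False using ordz p by (metis ord_id not_prime_1)
  qed
  \<comment> \<open>Only \<open>i\<close> modulo \<open>p\<close> matters for \<open>z\<close>; the shift by \<open>p\<close> makes the exponent prime to \<open>r\<close>.\<close>
  define k where "k = (if r dvd i then i + p else i)"
  \<comment> \<open>If \<open>r\<close> divided both \<open>i\<close> and \<open>i + p\<close>, then
    \<open>r = p\<close> would divide \<open>i\<close>.\<close>
  have "\<not> p dvd k" "\<not> r dvd k"
    using ndvd p r by (auto simp: k_def dvd_add_right_iff primes_dvd_imp_eq dest: primes_dvd_imp_eq)
  then have cop: "coprime (p * r) k"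
    using p r by (simp add: prime_imp_coprime)
  have "ord (x [^] k) = p * r"
    using ord_pow_gen[OF xc, of k] cop ordx \<open>\<not> p dvd k\<close> by auto
  moreover have "(x [^] k) [^] r = z"
  proof -
    have "(x [^] k) [^] r = (x [^] r) [^] k"
      using xc by (simp add: nat_pow_pow mult.commute)
    also have "\<dots> = (x [^] r) [^] i"
      using xc ordxr pow_ord_eq_1[of "x [^] r"] by (auto simp: k_def simp flip: nat_pow_mult)
    finally show ?thesis by (simp add: i)
  qed
  moreover have "x [^] k \<in> generate G {a}"
    by (rule generate_singleton_trans[OF a nat_pow_in_generate[OF xc] xa])
  ultimately show ?thesis using that by blast
qed

text \<open>Bezout writes \<open>a\<close> as a product of integer powers of \<open>a [^] p\<close>
  and \<open>a [^] q\<close>.\<close>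

lemma in_generate_if_coprime_powers:
  fixes p q :: nat
  assumes a: "a \<in> carrier G" and c: "c \<in> carrier G" and cop: "coprime p q"
    and ap: "a [^] p \<in> generate G {c}" and aq: "a [^] q \<in> generate G {c}"
  shows "a \<in> generate G {c}"
proof -
  have sub: "subgroup (generate G {c}) G"
    using c by (intro generate_is_subgroup) auto
  obtain u v where uv: "u * int p + v * int q = gcd (int p) (int q)"
    using bezout_int by blast
  then have "int p * u + int q * v = 1"
    using cop by (simp add: mult.commute)
  then have "a = (a [^] p) [^] u \<otimes> (a [^] q) [^] v"
    using a by (metis int_pow_1 int_pow_int int_pow_mult int_pow_pow)
  then show ?thesis
    using subgroup.m_closed[OF sub] subgroup_int_pow_closed[OF sub] ap aq by metis
qed

section \<open>From an induced path to elements of orders \<open>p * r\<close> and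
  \<open>p * q\<close>\<close>

text \<open>Here \<open>a\<close>, \<open>b\<close>, \<open>c\<close> are three vertices of the
  path; the fourth enters only through \<open>q\<close>. The conclusion binds its primes anew, since
  the last case exchanges \<open>p\<close> and \<open>q\<close>.\<close>

lemma exists_orders_if_overlapping_cyclic:
  fixes p q :: nat
  assumes fin: "finite (carrier G)" and a: "a \<in> carrier G" and c: "c \<in> carrier G"
    and ac: "a \<notin> generate G {c}"
    and ba: "b \<in> generate G {a}" and bc: "b \<in> generate G {c}"
    and p: "prime p" and q: "prime q" and pq: "p \<noteq> q"
    and pb: "p dvd ord b" and qc: "q dvd ord c"
  shows "\<exists>g \<in> carrier G. \<exists>h \<in> carrier G. \<exists>p q r :: nat.
       prime p \<and> prime q \<and> prime r \<and> p \<noteq> q \<and> ord g = p * r \<and> ord h = p * q \<and>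
       g [^] r = h [^] q \<and> (q = r \<longrightarrow> g [^] p \<notin> generate G {h [^] p})"
proof -
  have b: "b \<in> carrier G" using generate_singleton_carrier[OF a ba] .
  have pos: "ord a > 0" "ord b > 0" "ord c > 0" "p > 0" "q > 0"
    using ord_ge_1[OF fin] a b c p q by (auto simp: prime_gt_0_nat Suc_le_eq)
  have "p dvd ord c" using ord_dvd_if_in_generate[OF c bc] pb by (rule dvd_trans[rotated])
  then have "p * q dvd ord c"
    using qc p q pq by (simp add: divides_mult primes_coprime)
  then obtain s where s: "ord c = p * q * s" by (rule dvdE)
  define h where "h = c [^] s"
  have h: "h \<in> carrier G" and hc: "h \<in> generate G {c}"
    using c nat_pow_in_generate by (auto simp: h_def)
  have ordh: "ord h = p * q"
    using pos s by (simp add: h_def ord_pow[OF c])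
  have ordhq: "ord (h [^] q) = p" and ordhp: "ord (h [^] p) = q"
    using pos by (simp_all add: ord_pow[OF h] ordh)
  have hqc: "h [^] q \<in> generate G {c}" and hpc: "h [^] p \<in> generate G {c}"
    using generate_singleton_trans[OF c nat_pow_in_generate[OF h] hc] by auto
  \<comment> \<open>Both elements lie in \<open>generate G {c}\<close>, where order \<open>p\<close>
    dividing \<open>ord b\<close> suffices.\<close>
  have "h [^] q \<in> generate G {b}"
    using in_generate_if_ord_dvd[OF fin c hqc bc] pb ordhq by simp
  then have hqa: "h [^] q \<in> generate G {a}"
    using ba generate_singleton_trans[OF a] by blast
  have pa: "p dvd ord a"
    using ord_dvd_if_in_generate[OF a hqa] ordhq by simp
  show ?thesis
  \<comment> \<open>For \<open>r \<noteq> q\<close> the last condition is vacuous, so any root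
    serves; \<open>r = p\<close> is included.\<close>
  proof (cases "\<exists>r. prime r \<and> r \<noteq> q \<and> p * r dvd ord a")
    case True
    then obtain r where r: "prime r" "r \<noteq> q" "p * r dvd ord a" by blast
    obtain g where "g \<in> generate G {a}" "ord g = p * r" "g [^] r = h [^] q"
      using exists_root_in_cyclic[OF fin a p r(1,3) hqa ordhq] .
    then show ?thesis
      using generate_singleton_carrier[OF a] h p q pq r ordh by blast
  next
    case False
    obtain m where m: "ord a = p * m" using pa by (rule dvdE)
    have only_q: "r = q" if "prime r" "r dvd m" for r
      using False that m by auto
    have "m \<noteq> 1"
    proof
      assume "m = 1"
      then have "a \<in> generate G {h [^] q}"
        using in_generate_if_ord_dvd[OF fin a generate.incl hqa] m ordhq by simp
      then show False using ac hqc generate_singleton_trans[OF c] by blast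
    qed
    then have "q dvd m" using only_q prime_factor_nat by blast
    then have pqa: "p * q dvd ord a" by (simp add: m)
    obtain g where ga: "g \<in> generate G {a}" and ordg: "ord g = p * q" and g: "g [^] q = h [^] q"
      using exists_root_in_cyclic[OF fin a p q pqa hqa ordhq] .
    have gc: "g \<in> carrier G" using generate_singleton_carrier[OF a ga] .
    show ?thesis
    proof (cases "g [^] p \<in> generate G {h [^] p}")
      case False
      then show ?thesis using gc h p q pq ordg ordh g by blast
    next
      case True
      have ordgp: "ord (g [^] p) = q"
        using pos by (simp add: ord_pow[OF gc] ordg)
      \<comment> \<open>Both powers have order \<open>q\<close>, so they generate the same
        subgroup.\<close>
      have "h [^] p \<in> generate G {g [^] p}"
        using in_generate_if_ord_dvd[OF fin _ generate.incl True] h ordhp ordgp by simp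
      moreover have "g [^] p \<in> generate G {a}"
        by (rule generate_singleton_trans[OF a nat_pow_in_generate[OF gc] ga])
      ultimately have hpa: "h [^] p \<in> generate G {a}"
        by (rule generate_singleton_trans[OF a])
      obtain t where t: "m = q * t" using \<open>q dvd m\<close> by (rule dvdE)
      have "t \<noteq> 1"
      proof
        assume "t = 1"
        then have orda: "ord a = p * q" using m t by simp
        have "ord (a [^] p) = q" "ord (a [^] q) = p"
          using pos by (simp_all add: ord_pow[OF a] orda)
        then have "a [^] p \<in> generate G {h [^] p}" "a [^] q \<in> generate G {h [^] q}"
          using in_generate_if_ord_dvd[OF fin a nat_pow_in_generate[OF a]] hpa hqa ordhp ordhq
          by simp_all
        then have "a [^] p \<in> generate G {c}" "a [^] q \<in> generate G {c}"
          using generate_singleton_trans[OF c] hpc hqc by blast+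
        then show False
          using in_generate_if_coprime_powers[OF a c] primes_coprime[OF p q pq] ac by blast
      qed
      then obtain r where r: "prime r" "r dvd t" using prime_factor_nat by blast
      then have "r = q" using only_q t by simp
      then have "q * q dvd ord a" using r t m by auto
      \<comment> \<open>The triple \<open>(p, q, r)\<close> of the conclusion becomes
        \<open>(q, p, q)\<close>; its premise \<open>q = r\<close> now reads \<open>p = q\<close>,
        which is false.\<close>
      then obtain g' where "g' \<in> generate G {a}" "ord g' = q * q" "g' [^] q = h [^] p"
        using exists_root_in_cyclic[OF fin a q q _ hpa ordhp] by blast
      moreover have "ord h = q * p" using ordh by simp
      ultimately show ?thesis
        using generate_singleton_carrier[OF a] h p q pq by metis
    qed
  qed
qed

text \<open>Neither of \<open>ord b\<close> and \<open>ord d\<close> divides the other, so each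
  exceeds the other in the multiplicity of some prime; the opposite strict inequalities make the two
  primes distinct.\<close>

lemma primes_if_incomparable_in_cyclic:
  assumes fin: "finite (carrier G)" and c: "c \<in> carrier G"
    and b: "b \<in> generate G {c}" and d: "d \<in> generate G {c}"
    and bd: "b \<notin> generate G {d}" and db: "d \<notin> generate G {b}"
  obtains p q :: nat where "prime p" "prime q" "p \<noteq> q" "p dvd ord b" "q dvd ord c"
proof -
  have pos: "ord b \<noteq> 0" "ord d \<noteq> 0"
    using ord_ge_1[OF fin generate_singleton_carrier[OF c b]]
      ord_ge_1[OF fin generate_singleton_carrier[OF c d]] by simp_all
  have "\<not> ord b dvd ord d" "\<not> ord d dvd ord b"
    using in_generate_if_ord_dvd[OF fin c b d] in_generate_if_ord_dvd[OF fin c d b] bd db by auto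
  then obtain p q where pq: "prime p" "multiplicity p (ord d) < multiplicity p (ord b)"
    "prime q" "multiplicity q (ord b) < multiplicity q (ord d)"
    using multiplicity_le_imp_dvd[OF pos(1), of "ord d"] multiplicity_le_imp_dvd[OF pos(2), of "ord b"]
    by (meson not_less)
  then have "p dvd ord b" "q dvd ord d"
    using not_dvd_imp_multiplicity_0[of p "ord b"] not_dvd_imp_multiplicity_0[of q "ord d"] by auto
  moreover have "p \<noteq> q" using pq by auto
  ultimately show ?thesis
    using that[of p q] pq dvd_trans[OF _ ord_dvd_if_in_generate[OF c d]] by simp
qed

section \<open>Edges and induced paths\<close>

lemma power_graph_arc_iff:
  "(u, v) \<in> parcs (power_graph G) \<longleftrightarrow> u \<in> carrier G \<and> v \<in> carrier G \<and> u \<noteq> v \<and>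
     (u \<in> generate G {v} \<or> v \<in> generate G {u})"
  by (cases "u \<in> carrier G"; cases "v \<in> carrier G") (simp_all add: power_graph_def generate_pow)

end

text \<open>Symmetry and absence of loops reduce the equation between arc sets to one condition for
  each of the six pairs of vertices.\<close>

lemma not_cograph_iff_induced_path:
  assumes "pair_graph \<Gamma>"
  shows "\<not> cograph (with_proj \<Gamma>) \<longleftrightarrow>
    (\<exists>a b c d. distinct [a, b, c, d] \<and>
      (a, b) \<in> parcs \<Gamma> \<and> (b, c) \<in> parcs \<Gamma> \<and> (c, d) \<in> parcs \<Gamma> \<and>
      (a, c) \<notin> parcs \<Gamma> \<and> (a, d) \<notin> parcs \<Gamma> \<and> (b, d) \<notin> parcs \<Gamma>)"
    (is "_ \<longleftrightarrow> ?P4")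
proof -
  interpret pair_graph \<Gamma> by (rule assms)
  have sym: "(u, v) \<in> parcs \<Gamma> \<longleftrightarrow> (v, u) \<in> parcs \<Gamma>" for u v
    using graph_symmetric by blast
  have verts: "u \<in> pverts \<Gamma>" "v \<in> pverts \<Gamma>" "u \<noteq> v" if "(u, v) \<in> parcs \<Gamma>" for u v
    using in_arcsD1[OF that] in_arcsD2[OF that] no_loops[OF that] by simp_all
  have "(\<exists>a b c d. {a, b, c, d} \<subseteq> pverts \<Gamma> \<and> distinct [a, b, c, d] \<and>
       parcs \<Gamma> \<inter> {a, b, c, d} \<times> {a, b, c, d} =
         {(a, b), (b, a), (b, c), (c, b), (c, d), (d, c)}) \<longleftrightarrow> ?P4"
  proof (intro iffI; elim exE conjE)
    fix a b c d
    assume dist: "distinct [a, b, c, d]"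
      and eq: "parcs \<Gamma> \<inter> {a, b, c, d} \<times> {a, b, c, d} =
        {(a, b), (b, a), (b, c), (c, b), (c, d), (d, c)}"
    have "e \<in> parcs \<Gamma> \<longleftrightarrow> e \<in> {(a, b), (b, a), (b, c), (c, b), (c, d), (d, c)}"
      if "e \<in> {a, b, c, d} \<times> {a, b, c, d}" for e
      using eq that by blast
    from this[of "(a, b)"] this[of "(b, c)"] this[of "(c, d)"]
      this[of "(a, c)"] this[of "(a, d)"] this[of "(b, d)"]
    show ?P4
      using dist by (intro exI[of _ a] exI[of _ b] exI[of _ c] exI[of _ d]) auto
  next
    fix a b c d
    assume *: "distinct [a, b, c, d]" "(a, b) \<in> parcs \<Gamma>" "(b, c) \<in> parcs \<Gamma>"
      "(c, d) \<in> parcs \<Gamma>" "(a, c) \<notin> parcs \<Gamma>" "(a, d) \<notin> parcs \<Gamma>" "(b, d) \<notin> parcs \<Gamma>"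
    have loops: "(x, x) \<notin> parcs \<Gamma>" for x using verts(3)[of x x] by auto
    have rev: "(b, a) \<in> parcs \<Gamma>" "(c, b) \<in> parcs \<Gamma>" "(d, c) \<in> parcs \<Gamma>"
      "(c, a) \<notin> parcs \<Gamma>" "(d, a) \<notin> parcs \<Gamma>" "(d, b) \<notin> parcs \<Gamma>"
      using *(2-) sym[of a b] sym[of b c] sym[of c d] sym[of a c] sym[of a d] sym[of b d] by simp_all
    have "parcs \<Gamma> \<inter> {a, b, c, d} \<times> {a, b, c, d} =
        {(a, b), (b, a), (b, c), (c, b), (c, d), (d, c)}"
      using *(2-) rev loops by auto
    moreover have "{a, b, c, d} \<subseteq> pverts \<Gamma>" using *(2-4) verts(1,2) by simp
    ultimately show "\<exists>a b c d. {a, b, c, d} \<subseteq> pverts \<Gamma> \<and> distinct [a, b, c, d] \<and>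
       parcs \<Gamma> \<inter> {a, b, c, d} \<times> {a, b, c, d} =
         {(a, b), (b, a), (b, c), (c, b), (c, d), (d, c)}"
      using *(1) by (intro exI conjI)
  qed
  then show ?thesis
    using not_cograph_iff[OF pair_wf_digraph_axioms] by simp
qed

theorem theorem3p1:
  fixes G :: "('a, 'm) monoid_scheme"
  assumes "group G" and "finite (carrier G)"
  shows "\<not> cograph (with_proj (power_graph G)) \<longleftrightarrow>
    (\<exists>g \<in> carrier G. \<exists>h \<in> carrier G. \<exists>p q r :: nat.
       prime p \<and> prime q \<and> prime r \<and> p \<noteq> q \<and>
       group.ord G g = p * r \<and> group.ord G h = p * q \<and>
       g [^]\<^bsub>G\<^esub> r = h [^]\<^bsub>G\<^esub> q \<and>
       (q = r \<longrightarrow> g [^]\<^bsub>G\<^esub> p \<notin> generate G {h [^]\<^bsub>G\<^esub> p}))"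
    (is "_ \<longleftrightarrow> ?R")
proof -
  interpret group G by (rule assms(1))
  note fin = assms(2)
  note P4_iff = not_cograph_iff_induced_path[OF pair_graph_power_graph[OF fin]]
  show ?thesis
  proof
    assume "\<not> cograph (with_proj (power_graph G))"
    then obtain a b c d where dist: "distinct [a, b, c, d]"
      and carr: "a \<in> carrier G" "b \<in> carrier G" "c \<in> carrier G" "d \<in> carrier G"
      and ab: "a \<in> generate G {b} \<or> b \<in> generate G {a}"
      and bc: "b \<in> generate G {c} \<or> c \<in> generate G {b}"
      and cd: "c \<in> generate G {d} \<or> d \<in> generate G {c}"
      and ac: "a \<notin> generate G {c}" "c \<notin> generate G {a}"
      and bd: "b \<notin> generate G {d}" "d \<notin> generate G {b}"
      unfolding P4_iff power_graph_arc_iff by auto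
    \<comment> \<open>Stated for arbitrary vertices, as it is applied to the path and to its
      reversal.\<close>
    have from_zigzag: ?R
      if zigzag: "b \<in> generate G {a}" "b \<in> generate G {c}" "d \<in> generate G {c}"
        "a \<in> carrier G" "c \<in> carrier G" "a \<notin> generate G {c}"
        "b \<notin> generate G {d}" "d \<notin> generate G {b}" for a b c d
    proof -
      obtain p q :: nat where "prime p" "prime q" "p \<noteq> q" "p dvd ord b" "q dvd ord c"
        using primes_if_incomparable_in_cyclic[OF fin zigzag(5,2,3,7,8)] .
      then show ?R
        using exists_orders_if_overlapping_cyclic[OF fin zigzag(4,5,6,1,2)] by blast
    qed
    show ?R
    \<comment> \<open>The direction of the first edge fixes the others: two consecutive edges in the
      same direction would compose to a forbidden chord.\<close>
    proof (cases "b \<in> generate G {a}")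
      case True
      then have "c \<notin> generate G {b}" using ac(2) generate_singleton_trans[OF carr(1)] by blast
      then have "b \<in> generate G {c}" using bc by blast
      moreover from this have "c \<notin> generate G {d}" using bd(1) generate_singleton_trans[OF carr(4)] by blast
      ultimately show ?R using from_zigzag[of b a c d] True cd carr ac bd by simp
    next
      case False
      then have "a \<in> generate G {b}" using ab by blast
      moreover from this have "b \<notin> generate G {c}" using ac(1) generate_singleton_trans[OF carr(3)] by blast
      then have "c \<in> generate G {b}" using bc by blast
      moreover from this have "d \<notin> generate G {c}" using bd(2) generate_singleton_trans[OF carr(2)] by blast
      then have "c \<in> generate G {d}" using cd by blast
      ultimately show ?R using from_zigzag[of c d b a] carr ac bd by simp
    qed
  next
    assume ?R
    then obtain g h and p q r :: nat where g: "g \<in> carrier G" and h: "h \<in> carrier G"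
      and prime: "prime p" "prime q" "prime r" and pq: "p \<noteq> q"
      and ordg: "ord g = p * r" and ordh: "ord h = p * q" and gh: "g [^]\<^bsub>G\<^esub> r = h [^]\<^bsub>G\<^esub> q"
      and qr: "q = r \<longrightarrow> g [^]\<^bsub>G\<^esub> p \<notin> generate G {h [^]\<^bsub>G\<^esub> p}"
      by blast
    have gt: "p > 1" "q > 1" "r > 1" using prime prime_gt_1_nat by blast+
    define z where "z = h [^]\<^bsub>G\<^esub> q"
    define w where "w = h [^]\<^bsub>G\<^esub> p"
    have zw: "z \<in> carrier G" "w \<in> carrier G" using h by (auto simp: z_def w_def)
    have ordz: "ord z = p" and ordw: "ord w = q"
      using gt by (simp_all add: z_def w_def ord_pow[OF h] ordh)
    have ordgp: "ord (g [^]\<^bsub>G\<^esub> p) = r"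
      using gt by (simp add: ord_pow[OF g] ordg)
    have zg: "z \<in> generate G {g}" and zh: "z \<in> generate G {h}" and wh: "w \<in> generate G {h}"
      using nat_pow_in_generate[OF g, of r] nat_pow_in_generate[OF h] gh
      by (auto simp: z_def w_def)
    have ndvd: "\<not> p dvd q" "\<not> q dvd p"
      using prime pq primes_dvd_imp_eq by blast+
    then have zw_inc: "z \<notin> generate G {w}" "w \<notin> generate G {z}"
      using ord_dvd_if_in_generate[of w z] ord_dvd_if_in_generate[of z w] zw ordz ordw by auto
    have gh_inc: "g \<notin> generate G {h}"
    proof
      assume gin: "g \<in> generate G {h}"
      then have "r dvd q"
        using ord_dvd_if_in_generate[OF h] ordg ordh gt by fastforce
      then have "q = r" using prime primes_dvd_imp_eq by blast
      moreover have "g [^]\<^bsub>G\<^esub> p \<in> generate G {h}"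
        by (rule generate_singleton_trans[OF h nat_pow_in_generate[OF g] gin])
      \<comment> \<open>Both elements have order \<open>q\<close> in the cyclic group of
        \<open>h\<close>, which contradicts condition (b).\<close>
      then have "g [^]\<^bsub>G\<^esub> p \<in> generate G {w}"
        using in_generate_if_ord_dvd[OF fin h _ wh] \<open>q = r\<close> ordgp ordw by simp
      ultimately show False using qr by (simp add: w_def)
    qed
    have wg_inc: "w \<notin> generate G {g}"
    proof
      assume win: "w \<in> generate G {g}"
      then have "q dvd p * r"
        using ord_dvd_if_in_generate[OF g] ordg ordw by metis
      \<comment> \<open>The prime \<open>q\<close> does not divide \<open>p\<close>, so it divides
        \<open>r\<close>; then \<open>g [^] p\<close> and \<open>w\<close> have equal order in the
        cyclic group of \<open>g\<close>.\<close>
      then have "q = r"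
        using prime ndvd primes_dvd_imp_eq prime_dvd_mult_iff by metis
      then have "g [^]\<^bsub>G\<^esub> p \<in> generate G {w}"
        using in_generate_if_ord_dvd[OF fin g nat_pow_in_generate[OF g] win] ordgp ordw by simp
      then show False using qr \<open>q = r\<close> by (simp add: w_def)
    qed
    have hg_inc: "h \<notin> generate G {g}"
      using wg_inc wh generate_singleton_trans[OF g] by blast
    have gw_inc: "g \<notin> generate G {w}"
      using gh_inc wh generate_singleton_trans[OF h] by blast
    have "g \<noteq> z" "z \<noteq> h" "h \<noteq> w"
      using ordz ordw ordg ordh gt by auto
    moreover have "g \<noteq> h" "g \<noteq> w" "z \<noteq> w"
      using gh_inc gw_inc zw_inc generate.incl[of _ "{_}" G] by auto
    ultimately have "distinct [g, z, h, w]"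
      by simp
    then show "\<not> cograph (with_proj (power_graph G))"
      unfolding P4_iff power_graph_arc_iff
      using g h zw zg zh wh zw_inc gh_inc wg_inc hg_inc gw_inc
      by (intro exI[of _ g] exI[of _ z] exI[of _ h] exI[of _ w]) auto
  qed
qed

end
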